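(* Let $P$ be a source program with compilation $Q$, under the compiler-correctness conditions (safety of $P$, sufficient fresh stack memory in the initial target memory, disjointness of writable input pointers). Let $\mathscr{C}_P$ and $\mathscr{C}_Q$ be the oracle systems induced by $P$ and $Q$, respectively. Then for every adversary $\mathscr{A}$ and every winning condition $\mathsf{win}$, $$\Pr[\mathscr{A}\text{ wins against }\mathscr{C}_P]=\Pr[\mathscr{A}\text{ wins against }\mathscr{C}_Q],$$ where an adversary wins against a challenger if their interaction produces a trace that satisfies the winning condition.
   Context: Interaction trees. $\mathsf{itree}\ \mathsf{E}\ \mathsf{R}$ is the coinductive type $t::=\mathsf{Ret}(r)\mid\mathsf{Tau}(t)\mid\mathsf{Vis}(e,k)$ with $r:\mathsf{R}$, $e:\mathsf{E}\,\mathsf{A}$, $k:\mathsf{A}\to\mathsf{itree}\ \mathsf{E}\ \mathsf{R}$; $+'$ is disjoint union of event families. $\mathsf{Rnd}(X)$, for a finite nonempty set $X$, is an event with answer type $X$. $\mathsf{Err}$ is the family of error events. Weak bisimilarity $t_1\approx_\phi t_2$ (for a relation $\phi$ on results) is generated by: $\mathsf{Ret}(r_1)\approx_\phi\mathsf{Ret}(r_2)$ if $r_1\phi r_2$; coinductively $\mathsf{Tau}(t_1)\approx_\phi\mathsf{Tau}(t_2)$ if $t_1\approx_\phi t_2$ and $\mathsf{Vis}(e,k_1)\approx_\phi\mathsf{Vis}(e,k_2)$ if $k_1(a)\approx_\phi k_2(a)$ for all $a$; inductively (finitely often between coinductive steps) $\mathsf{Tau}(t_1)\approx_\phi t_2$,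 resp. $t_1\approx_\phi\mathsf{Tau}(t_2)$, if $t_1\approx_\phi t_2$. Probabilistic semantics. For $t:\mathsf{itree}\ \mathsf{Rnd}\ \mathsf{R}$, $\llbracket t\rrbracket(r)=\lim_n\llbracket t\rrbracket^n(r)$ where $\llbracket t\rrbracket^0=0$, $\llbracket\mathsf{Ret}(r)\rrbracket^{n+1}=\mathbb{1}_r$, $\llbracket\mathsf{Tau}(t)\rrbracket^{n+1}=\llbracket t\rrbracket^n$, $\llbracket\mathsf{Vis}(\mathsf{Rnd}(X),k)\rrbracket^{n+1}(r)=\frac1{|X|}\sum_{x\in X}\llbracket k(x)\rrbracket^n(r)$. Programs and compilation. The source program $P$ (in the Jasmin language) and the target program $Q$ (assembly) each assign to a function name $f$ and an initial state $s$ (source, resp. target) a tree $(\!|P(f)|\!)_s$, resp. $(\!|Q(f)|\!)_s$, in $\mathsf{itree}\ (\mathsf{Err}+'\mathsf{Rnd})\ \mathsf{State}$ with final states as results. $Q$ being the compilation of $P$ (by the Jasmin compiler) is used through the compiler correctness property: there is a relation $\preccurlyeq$ between source and target states such that, for every function $f$, under the compiler-correctness conditions, $$\sigma\preccurlyeq\tau\implies(\!|P(f)|\!)_\sigma\approx_{\preccurlyeq}(\!|Q(f)|\!)_\tau .$$ The compiler-correctness conditions are: $P$ is safe (on the initial states below its trees contain no $\mathsf{Err}$ event, and in every final state the results are fully initialized); the initial target memory has enough allocated fresh memory for the stack of each function; each writable input pointer is disjoint from all other input pointers and from the data section. Arguments and results. Each function $f$ has a type $X_f$ of inputs and $Y_f$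 of outputs. On the source side an input $x\in X_f$ is encoded as an initial state $\mathrm{in}_P(f,x)$ (inputs stored in the variable map, with a fixed initial memory) and outputs are read by $\mathrm{out}_P(f,\cdot)$ from the final state's variables. On the target side $\mathrm{in}_Q(f,x)$ writes array inputs to memory at given pointers and initializes the corresponding registers with these pointers, and $\mathrm{out}_Q(f,\cdot)$ reads the outputs from the final state similarly. The relation $\preccurlyeq$ relates target values that are equal to, or more defined than, the source values, with source arrays corresponding to the target memory regions pointed to; hence: (i) $\mathrm{in}_P(f,x)\preccurlyeq\mathrm{in}_Q(f,x)$ for all $f$, $x$; (ii) if $\sigma'\preccurlyeq\tau'$ and the results of $f$ in $\sigma'$ are fully initialized, then $\mathrm{out}_P(f,\sigma')=\mathrm{out}_Q(f,\tau')$. Write $\mathrm{Run}_P(f,x)$ for the tree that runs $(\!|P(f)|\!)_{\mathrm{in}_P(f,x)}$ and returns $\mathrm{out}_P(f,\cdot)$ of the final state, and similarly $\mathrm{Run}_Q(f,x)$; having no $\mathsf{Err}$ events, they are viewed as elements of $\mathsf{itree}\ \mathsf{Rnd}\ Y_f$. Oracle systems. Fix functions $\mathsf{I},\mathsf{O}:\mathbb{N}\to\mathsf{Type}$ (input and output type of each oracle) and a type $\mathbb{M}$ of oracle memories with an initial memory $\mu_0$. A challenger (oracle system) is a family $\mathscr{C}:(n:\mathbb{N})\to(\mathsf{I}_n\times\mathbb{M})\to\mathsf{itree}\ \mathsf{Rnd}\ (\mathsf{O}_n\times\mathbb{M})$. The oracle systems induced by $P$ and $Q$ are given by a common family of oracle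 implementations which may sample randomness, use the oracle memory, and call the functions of the program: formally, a family $o_n:\mathsf{I}_n\times\mathbb{M}\to\mathsf{itree}\ (\mathsf{Fun}+'\mathsf{Rnd})\ (\mathsf{O}_n\times\mathbb{M})$, where $\mathsf{Fun}(f,x)$ is an event with $x\in X_f$ and answer type $Y_f$; $\mathscr{C}_P$ (resp. $\mathscr{C}_Q$) is obtained by interpreting every event $\mathsf{Fun}(f,x)$ by $\mathrm{Run}_P(f,x)$ (resp. $\mathrm{Run}_Q(f,x)$), leaving $\mathsf{Rnd}$ events unchanged. (For example, for KEM-IND-CCA the oracles are: an initialization oracle that runs key generation, stores the keys and returns the public key; a challenge oracle using encapsulation; a decapsulation oracle; and a finalization oracle receiving the guess.) Adversaries and games. An adversary is a tree $\mathscr{A}:\mathsf{itree}\ (\mathsf{Que}+'\mathsf{Rnd})\ \mathsf{Unit}$, where $\mathsf{Que}(n,i)$ ($n\in\mathbb{N}$, $i\in\mathsf{I}_n$) is an oracle query event with answer type $\mathsf{O}_n$. The game between $\mathscr{A}$ and $\mathscr{C}$ is the tree over $\mathsf{Rnd}$ obtained by executing $\mathscr{A}$ starting with oracle memory $\mu_0$ and empty trace, interpreting each event $\mathsf{Que}(n,i)$ in the current memory $\mu$ by running $\mathscr{C}_n(i,\mu)$, which yields $(o,\mu')$: the answer is $o$, the memory becomes $\mu'$, and $(n,i,o)$ is appended to the trace; $\mathsf{Rnd}$ events are left unchanged. The result of the game is the final trace. A winning condition is a predicate $\mathsf{win}$ from finite traces of triples $(n,i,o)$, with $i\in\mathsf{I}_n$,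 $o\in\mathsf{O}_n$, to $\{0,1\}$, and $\Pr[\mathscr{A}\text{ wins against }\mathscr{C}]$ is the sum of $\llbracket\text{game}\rrbracket(w)$ over traces $w$ with $\mathsf{win}(w)=1$. *)

theory Defs
  imports "HOL-Analysis.Infinite_Sum"
begin

section \<open>Interaction trees\<close>

text \<open>
  HOL has no dependent types, so families of types are rendered as families of subsets of a type
  of values \<open>'a\<close>.  An event family is a type of events \<open>'e\<close> together with a function
  \<open>ans :: 'e \<Rightarrow> 'a set\<close> giving the answer type of each event.  A continuation is a total function
  on \<open>'a\<close>, but its values outside of \<open>ans e\<close> carry no meaning: every notion below ignores them.
  The disjoint union of two families has events \<open>'e1 + 'e2\<close> and answers \<open>case_sum ans1 ans2\<close>.
\<close>

codatatype (dead 'e, dead 'a, 'r) itree =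
    Ret 'r
  | Tau "('e, 'a, 'r) itree"
  | Vis 'e "'a \<Rightarrow> ('e, 'a, 'r) itree"

text \<open>
  \<open>itree_typed ev ans R t\<close>: all events of \<open>t\<close> belong to \<open>ev\<close> and all its results to \<open>R\<close>, along
  well-typed answers.
\<close>

coinductive itree_typed ::
  "'e set \<Rightarrow> ('e \<Rightarrow> 'a set) \<Rightarrow> 'r set \<Rightarrow> ('e, 'a, 'r) itree \<Rightarrow> bool"
  for ev ans R where
  "r \<in> R \<Longrightarrow> itree_typed ev ans R (Ret r)"
| "itree_typed ev ans R t \<Longrightarrow> itree_typed ev ans R (Tau t)"
| "e \<in> ev \<Longrightarrow> (\<forall>a\<in>ans e. itree_typed ev ans R (k a)) \<Longrightarrow> itree_typed ev ans R (Vis e k)"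

inductive subtree ::
  "('e \<Rightarrow> 'a set) \<Rightarrow> ('e, 'a, 'r) itree \<Rightarrow> ('e, 'a, 'r) itree \<Rightarrow> bool"
  for ans where
  "subtree ans t t"
| "subtree ans t u \<Longrightarrow> subtree ans (Tau t) u"
| "a \<in> ans e \<Longrightarrow> subtree ans (k a) u \<Longrightarrow> subtree ans (Vis e k) u"

text \<open>
  Weak bisimilarity: the one-step relation is inductive, so that only finitely many one-sided
  \<open>Tau\<close> steps occur between two uses of the coinductive argument \<open>S\<close>.
\<close>

inductive wbisim_step ::
  "('e \<Rightarrow> 'a set) \<Rightarrow> ('r \<Rightarrow> 's \<Rightarrow> bool) \<Rightarrow> (('e, 'a, 'r) itree \<Rightarrow> ('e, 'a, 's) itree \<Rightarrow> bool) \<Rightarrow>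
   ('e, 'a, 'r) itree \<Rightarrow> ('e, 'a, 's) itree \<Rightarrow> bool"
  for ans \<phi> S where
  Ret: "\<phi> r1 r2 \<Longrightarrow> wbisim_step ans \<phi> S (Ret r1) (Ret r2)"
| Tau: "S t1 t2 \<Longrightarrow> wbisim_step ans \<phi> S (Tau t1) (Tau t2)"
| Vis: "(\<forall>a\<in>ans e. S (k1 a) (k2 a)) \<Longrightarrow> wbisim_step ans \<phi> S (Vis e k1) (Vis e k2)"
| TauL: "wbisim_step ans \<phi> S t1 t2 \<Longrightarrow> wbisim_step ans \<phi> S (Tau t1) t2"
| TauR: "wbisim_step ans \<phi> S t1 t2 \<Longrightarrow> wbisim_step ans \<phi> S t1 (Tau t2)"

lemma wbisim_step_mono [mono]:
  assumes "S \<le> S'"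
  shows "wbisim_step ans \<phi> S t1 t2 \<longrightarrow> wbisim_step ans \<phi> S' t1 t2"
proof
  assume "wbisim_step ans \<phi> S t1 t2"
  then show "wbisim_step ans \<phi> S' t1 t2"
    using assms by induction (blast intro: wbisim_step.intros)+
qed

coinductive wbisim ::
  "('e \<Rightarrow> 'a set) \<Rightarrow> ('r \<Rightarrow> 's \<Rightarrow> bool) \<Rightarrow> ('e, 'a, 'r) itree \<Rightarrow> ('e, 'a, 's) itree \<Rightarrow> bool"
  for ans \<phi> where
  "wbisim_step ans \<phi> (wbisim ans \<phi>) t1 t2 \<Longrightarrow> wbisim ans \<phi> t1 t2"


section \<open>Random sampling and probabilistic semantics\<close>

typedef 'a rnd = "{X :: 'a set. finite X \<and> X \<noteq> {}}"
  morphisms support Rnd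
  by (rule exI[of _ "{undefined}"]) simp

primrec sem_upto :: "nat \<Rightarrow> ('a rnd, 'a, 'r) itree \<Rightarrow> 'r \<Rightarrow> real" where
  "sem_upto 0 t r = 0"
| "sem_upto (Suc n) t r =
    (case t of
       Ret r' \<Rightarrow> of_bool (r = r')
     | Tau t' \<Rightarrow> sem_upto n t' r
     | Vis e k \<Rightarrow> (1 / real (card (support e))) * (\<Sum>x\<in>support e. sem_upto n (k x) r))"

definition sem :: "('a rnd, 'a, 'r) itree \<Rightarrow> 'r \<Rightarrow> real" where
  "sem t r = lim (\<lambda>n. sem_upto n t r)"


section \<open>Interpretation of events\<close>

primcorec bind :: "('e, 'a, 'r) itree \<Rightarrow> ('r \<Rightarrow> ('e, 'a, 's) itree) \<Rightarrow> ('e, 'a, 's) itree" where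
  "bind t f =
    (case t of
       Ret r \<Rightarrow> f r
     | Tau t' \<Rightarrow> Tau (bind t' f)
     | Vis e k \<Rightarrow> Vis e (\<lambda>a. bind (k a) f))"

text \<open>
  Stateful interpretation of the events \<open>'e\<close> by handlers \<open>h e s\<close>, which return an answer and a
  new state; the events on the right of the sum are left unchanged.  It is defined as a machine
  that either runs the main tree in a state (\<open>Main\<close>) or runs a handler, remembering the
  continuation of the event being handled (\<open>Call\<close>).  The lemma \<open>interp_state_simps\<close> below gives
  the expected equations; as usual, a \<open>Tau\<close> guards each call and each return.
\<close>

datatype ('e, 'd, 'a, 'r, 's) config =
    is_Main: Main (main_tree: "('e + 'd, 'a, 'r) itree") (main_state: 's)
  | is_Call: Call (call_tree: "('d, 'a, 'a \<times> 's) itree") (call_cont: "'a \<Rightarrow> ('e + 'd, 'a, 'r) itree")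

primcorec interp_config ::
  "('e \<Rightarrow> 's \<Rightarrow> ('d, 'a, 'a \<times> 's) itree) \<Rightarrow> ('e, 'd, 'a, 'r, 's) config \<Rightarrow>
   ('d, 'a, 'r \<times> 's) itree" where
  "interp_config h c =
    (case c of
       Main t s \<Rightarrow>
         (case t of
            Ret r \<Rightarrow> Ret (r, s)
          | Tau t' \<Rightarrow> Tau (interp_config h (Main t' s))
          | Vis e k \<Rightarrow>
              (case e of
                 Inl e' \<Rightarrow> Tau (interp_config h (Call (h e' s) k))
               | Inr d \<Rightarrow> Vis d (\<lambda>a. interp_config h (Main (k a) s))))
     | Call u k \<Rightarrow>
         (case u of
            Ret p \<Rightarrow> Tau (interp_config h (Main (k (fst p)) (snd p)))
          | Tau u' \<Rightarrow> Tau (interp_config h (Call u' k))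
          | Vis d k' \<Rightarrow> Vis d (\<lambda>a. interp_config h (Call (k' a) k))))"

definition interp_state ::
  "('e \<Rightarrow> 's \<Rightarrow> ('d, 'a, 'a \<times> 's) itree) \<Rightarrow> ('e + 'd, 'a, 'r) itree \<Rightarrow> 's \<Rightarrow>
   ('d, 'a, 'r \<times> 's) itree" where
  "interp_state h t s = interp_config h (Main t s)"

lemma interp_config_Call:
  "interp_config h (Call u k) = bind u (\<lambda>(a, s). Tau (interp_state h (k a) s))"
proof (coinduction arbitrary: u rule: itree.coinduct_strong)
  case Eq_itree
  then show ?case
    by (cases u) (auto simp: interp_state_def rel_fun_def split: prod.splits)
qed

lemma interp_state_simps:
  "interp_state h (Ret r) s = Ret (r, s)"
  "interp_state h (Tau t) s = Tau (interp_state h t s)"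
  "interp_state h (Vis (Inl e) k) s =
     Tau (bind (h e s) (\<lambda>(a, s'). Tau (interp_state h (k a) s')))"
  "interp_state h (Vis (Inr d) k) s = Vis d (\<lambda>a. interp_state h (k a) s)"
  unfolding interp_config_Call[symmetric]
  by (simp_all add: interp_state_def interp_config.code[of h "Main _ _"])

definition interp ::
  "('e \<Rightarrow> ('d, 'a, 'a) itree) \<Rightarrow> ('e + 'd, 'a, 'r) itree \<Rightarrow> ('d, 'a, 'r) itree" where
  "interp h t = map_itree fst (interp_state (\<lambda>e _. map_itree (\<lambda>a. (a, ())) (h e)) t ())"


section \<open>Programs\<close>

type_synonym ('f, 'st, 'err, 'v) program = "'f \<Rightarrow> 'st \<Rightarrow> ('err + 'v rnd, 'v, 'st) itree"

text \<open>
  \<open>P\<close> is safe for \<open>f\<close> in the initial state \<open>\<sigma>\<close>; \<open>initialized f \<sigma>'\<close> says that the results of \<open>f\<close>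
  are fully initialized in \<open>\<sigma>'\<close>.
\<close>

definition safe ::
  "('err \<Rightarrow> 'v set) \<Rightarrow> ('f \<Rightarrow> 'st \<Rightarrow> bool) \<Rightarrow> ('f, 'st, 'err, 'v) program \<Rightarrow> 'f \<Rightarrow> 'st \<Rightarrow> bool" where
  "safe err_ans initialized P f \<sigma> \<longleftrightarrow>
    (\<forall>e k. \<not> subtree (case_sum err_ans support) (P f \<sigma>) (Vis (Inl e) k)) \<and>
    (\<forall>\<sigma>'. subtree (case_sum err_ans support) (P f \<sigma>) (Ret \<sigma>') \<longrightarrow> initialized f \<sigma>')"

text \<open>
  What the compiler-correctness conditions observe of target states: \<open>fresh \<tau>\<close> are the addresses
  of the allocated fresh memory of \<open>\<tau>\<close>; the function \<open>f\<close> has \<open>num_ptrs f\<close> pointer inputs, the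
  \<open>i\<close>-th of which has value \<open>ptr f \<tau> i\<close> in \<open>\<tau>\<close> and points to \<open>ptr_size f i\<close> bytes.
\<close>

record ('f, 'tgt) target_layout =
  stack_size :: "'f \<Rightarrow> nat"
  fresh :: "'tgt \<Rightarrow> nat set"
  data_section :: "nat set"
  num_ptrs :: "'f \<Rightarrow> nat"
  writable :: "'f \<Rightarrow> nat \<Rightarrow> bool"
  ptr_size :: "'f \<Rightarrow> nat \<Rightarrow> nat"
  ptr :: "'f \<Rightarrow> 'tgt \<Rightarrow> nat \<Rightarrow> nat"

definition enough_stack :: "('f, 'tgt) target_layout \<Rightarrow> 'f \<Rightarrow> 'tgt \<Rightarrow> bool" where
  "enough_stack L f \<tau> \<longleftrightarrow> (\<exists>b. {b..<b + stack_size L f} \<subseteq> fresh L \<tau>)"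

definition ptr_region :: "('f, 'tgt) target_layout \<Rightarrow> 'f \<Rightarrow> 'tgt \<Rightarrow> nat \<Rightarrow> nat set" where
  "ptr_region L f \<tau> i = {ptr L f \<tau> i..<ptr L f \<tau> i + ptr_size L f i}"

definition ptrs_disjoint :: "('f, 'tgt) target_layout \<Rightarrow> 'f \<Rightarrow> 'tgt \<Rightarrow> bool" where
  "ptrs_disjoint L f \<tau> \<longleftrightarrow>
    (\<forall>i<num_ptrs L f. writable L f i \<longrightarrow>
       ptr_region L f \<tau> i \<inter> data_section L = {} \<and>
       (\<forall>j<num_ptrs L f. j \<noteq> i \<longrightarrow> ptr_region L f \<tau> i \<inter> ptr_region L f \<tau> j = {}))"

definition compiler_correct ::
  "('err \<Rightarrow> 'v set) \<Rightarrow> ('f \<Rightarrow> 'src \<Rightarrow> bool) \<Rightarrow> ('f, 'tgt) target_layout \<Rightarrow> ('src \<Rightarrow> 'tgt \<Rightarrow> bool) \<Rightarrow>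
   ('f, 'src, 'err, 'v) program \<Rightarrow> ('f, 'tgt, 'err, 'v) program \<Rightarrow> bool" where
  "compiler_correct err_ans initialized L R P Q \<longleftrightarrow>
    (\<forall>f \<sigma> \<tau>. safe err_ans initialized P f \<sigma> \<longrightarrow> enough_stack L f \<tau> \<longrightarrow> ptrs_disjoint L f \<tau> \<longrightarrow>
       R \<sigma> \<tau> \<longrightarrow> wbisim (case_sum err_ans support) R (P f \<sigma>) (Q f \<tau>))"

primcorec diverge :: "('e, 'a, 'r) itree" where
  "diverge = Tau diverge"

text \<open>
  Trees without \<open>Err\<close> events are viewed as trees over \<open>Rnd\<close>; the value given to an \<open>Err\<close> event
  is irrelevant for them.
\<close>

primcorec drop_err :: "('err + 'd, 'a, 'r) itree \<Rightarrow> ('d, 'a, 'r) itree" where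
  "drop_err t =
    (case t of
       Ret r \<Rightarrow> Ret r
     | Tau t' \<Rightarrow> Tau (drop_err t')
     | Vis e k \<Rightarrow> (case e of Inl _ \<Rightarrow> diverge | Inr d \<Rightarrow> Vis d (\<lambda>a. drop_err (k a))))"

definition Run ::
  "('f, 'st, 'err, 'v) program \<Rightarrow> ('f \<Rightarrow> 'v \<Rightarrow> 'st) \<Rightarrow> ('f \<Rightarrow> 'st \<Rightarrow> 'v) \<Rightarrow> 'f \<Rightarrow> 'v \<Rightarrow>
   ('v rnd, 'v, 'v) itree" where
  "Run P inp out f x = drop_err (map_itree (out f) (P f (inp f x)))"


section \<open>Oracle systems, adversaries and games\<close>

datatype ('f, 'v) call = Fun 'f 'v

definition calls :: "('f \<Rightarrow> 'v set) \<Rightarrow> ('f, 'v) call set" where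
  "calls X = {Fun f x | f x. x \<in> X f}"

primrec call_ans :: "('f \<Rightarrow> 'v set) \<Rightarrow> ('f, 'v) call \<Rightarrow> 'v set" where
  "call_ans Y (Fun f x) = Y f"

datatype 'v query = Que nat 'v

definition queries :: "(nat \<Rightarrow> 'v set) \<Rightarrow> 'v query set" where
  "queries I = {Que n i | n i. i \<in> I n}"

primrec query_ans :: "(nat \<Rightarrow> 'v set) \<Rightarrow> 'v query \<Rightarrow> 'v set" where
  "query_ans Out (Que n i) = Out n"

type_synonym ('v, 'm) challenger = "nat \<Rightarrow> 'v \<times> 'm \<Rightarrow> ('v rnd, 'v, 'v \<times> 'm) itree"

type_synonym ('f, 'v, 'm) oracle_impl =
  "nat \<Rightarrow> 'v \<times> 'm \<Rightarrow> (('f, 'v) call + 'v rnd, 'v, 'v \<times> 'm) itree"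

type_synonym 'v adversary = "('v query + 'v rnd, 'v, unit) itree"

type_synonym 'v trace = "(nat \<times> 'v \<times> 'v) list"

definition oracle_impl_typed ::
  "('f \<Rightarrow> 'v set) \<Rightarrow> ('f \<Rightarrow> 'v set) \<Rightarrow> (nat \<Rightarrow> 'v set) \<Rightarrow> (nat \<Rightarrow> 'v set) \<Rightarrow>
   ('f, 'v, 'm) oracle_impl \<Rightarrow> bool" where
  "oracle_impl_typed X Y I Out orc \<longleftrightarrow>
    (\<forall>n. \<forall>i\<in>I n. \<forall>\<mu>.
       itree_typed (calls X <+> UNIV) (case_sum (call_ans Y) support) (Out n \<times> UNIV) (orc n (i, \<mu>)))"

definition adversary_typed ::
  "(nat \<Rightarrow> 'v set) \<Rightarrow> (nat \<Rightarrow> 'v set) \<Rightarrow> 'v adversary \<Rightarrow> bool" where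
  "adversary_typed I Out A \<longleftrightarrow>
    itree_typed (queries I <+> UNIV) (case_sum (query_ans Out) support) UNIV A"

definition induced ::
  "('f, 'v, 'm) oracle_impl \<Rightarrow> ('f \<Rightarrow> 'v \<Rightarrow> ('v rnd, 'v, 'v) itree) \<Rightarrow> ('v, 'm) challenger" where
  "induced orc run n p = interp (case_call run) (orc n p)"

primrec answer_query ::
  "('v, 'm) challenger \<Rightarrow> 'v query \<Rightarrow> 'm \<times> 'v trace \<Rightarrow> ('v rnd, 'v, 'v \<times> ('m \<times> 'v trace)) itree" where
  "answer_query C (Que n i) s =
    map_itree (\<lambda>(a, \<mu>'). (a, (\<mu>', snd s @ [(n, i, a)]))) (C n (i, fst s))"

definition game :: "'m \<Rightarrow> 'v adversary \<Rightarrow> ('v, 'm) challenger \<Rightarrow> ('v rnd, 'v, 'v trace) itree" where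
  "game \<mu>0 A C = map_itree (\<lambda>(_, (_, w)). w) (interp_state (answer_query C) A (\<mu>0, []))"

definition traces :: "(nat \<Rightarrow> 'v set) \<Rightarrow> (nat \<Rightarrow> 'v set) \<Rightarrow> 'v trace set" where
  "traces I Out = lists (SIGMA n:UNIV. I n \<times> Out n)"

definition win_prob ::
  "(nat \<Rightarrow> 'v set) \<Rightarrow> (nat \<Rightarrow> 'v set) \<Rightarrow> 'm \<Rightarrow> ('v trace \<Rightarrow> bool) \<Rightarrow> 'v adversary \<Rightarrow>
   ('v, 'm) challenger \<Rightarrow> real" where
  "win_prob I Out \<mu>0 win A C = (\<Sum>\<^sub>\<infinity>w\<in>{w \<in> traces I Out. win w}. sem (game \<mu>0 A C) w)"

end

theory Submission
  imports Defs
begin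

text \<open>
  Weak bisimilarity is preserved by everything from which a game is built.  For a stateful
  interpretation with weakly bisimilar handlers, no up-to technique is needed: a pair of
  configurations executing the same main tree, or executing weakly bisimilar handler calls with
  the same continuation, already forms a bisimulation.  Hence the two games are weakly bisimilar
  for equality on traces.  Finally, weakly bisimilar trees have the same probabilistic semantics,
  because each finite approximation of one is bounded by the semantics of the other.
\<close>

section \<open>Congruence properties of weak bisimilarity\<close>

text \<open>The generated coinduction rule lets a step end in \<open>S\<close> or in
  \<open>wbisim\<close>. Keeping only the first alternative makes the introduction rules of
  \<open>wbisim_step\<close> apply directly to a candidate \<open>S\<close>.\<close>

lemma wbisim_coinduct_step:
  assumes "S t1 t2"
    and "\<And>t1 t2. S t1 t2 \<Longrightarrow> wbisim_step ans \<phi> S t1 t2"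
  shows "wbisim ans \<phi> t1 t2"
  using assms(1)
proof (coinduction arbitrary: t1 t2)
  case wbisim
  then have "wbisim_step ans \<phi> S t1 t2"
    by (rule assms(2))
  then have "wbisim_step ans \<phi> (\<lambda>x y. S x y \<or> wbisim ans \<phi> x y) t1 t2"
    by (rule wbisim_step_mono[THEN mp, rotated]) auto
  then show ?case
    by simp
qed

lemma wbisim_unfold: "wbisim ans \<phi> t1 t2 \<Longrightarrow> wbisim_step ans \<phi> (wbisim ans \<phi>) t1 t2"
  by (erule wbisim.cases) simp

lemma wbisim_step_sym:
  "wbisim_step ans \<phi> S t1 t2 \<Longrightarrow> wbisim_step ans (\<lambda>x y. \<phi> y x) (\<lambda>x y. S y x) t2 t1"
  by (induction rule: wbisim_step.induct) (auto intro: wbisim_step.intros)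

lemma wbisim_sym:
  assumes "wbisim ans \<phi> t1 t2"
  shows "wbisim ans (\<lambda>x y. \<phi> y x) t2 t1"
proof (rule wbisim_coinduct_step[where S = "\<lambda>x y. wbisim ans \<phi> y x"])
  show "wbisim ans \<phi> t1 t2"
    by (rule assms)
qed (auto intro: wbisim_step_sym wbisim_unfold)

lemma wbisim_map_itree:
  assumes "wbisim ans \<phi> t1 t2"
    and "\<And>r s. \<phi> r s \<Longrightarrow> \<psi> (f r) (g s)"
  shows "wbisim ans \<psi> (map_itree f t1) (map_itree g t2)"
proof (rule wbisim_coinduct_step[where
      S = "\<lambda>x y. \<exists>t1 t2. x = map_itree f t1 \<and> y = map_itree g t2 \<and> wbisim ans \<phi> t1 t2"])
  let ?S = "\<lambda>x y. \<exists>t1 t2. x = map_itree f t1 \<and> y = map_itree g t2 \<and> wbisim ans \<phi> t1 t2"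
  fix x y
  assume "?S x y"
  then obtain t1 t2 where xy: "x = map_itree f t1" "y = map_itree g t2"
    and "wbisim ans \<phi> t1 t2"
    by blast
  from this(3)[THEN wbisim_unfold]
  show "wbisim_step ans \<psi> ?S x y"
    unfolding xy
    by induction (auto simp: o_def intro: wbisim_step.TauL wbisim_step.TauR
        intro!: wbisim_step.Ret wbisim_step.Tau wbisim_step.Vis assms(2))
qed (use assms(1) in blast)

section \<open>Interpretation with weakly bisimilar handlers\<close>

lemma interp_config_simps:
  "interp_config h (Main (Ret r) s) = Ret (r, s)"
  "interp_config h (Main (Tau t) s) = Tau (interp_config h (Main t s))"
  "interp_config h (Main (Vis (Inl e) k) s) = Tau (interp_config h (Call (h e s) k))"
  "interp_config h (Main (Vis (Inr d) k) s) = Vis d (\<lambda>a. interp_config h (Main (k a) s))"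
  "interp_config h (Call (Ret p) k) = Tau (interp_config h (Main (k (fst p)) (snd p)))"
  "interp_config h (Call (Tau u) k) = Tau (interp_config h (Call u k))"
  "interp_config h (Call (Vis d k') k) = Vis d (\<lambda>a. interp_config h (Call (k' a) k))"
  by (subst interp_config.code; simp)+

text \<open>Related handlers return the same answer and the same state, so both sides resume the
  same main tree. The conjunct \<open>fst p \<in> ans e\<close> is carried along because
  continuations are typed only on \<open>ans e\<close>.\<close>

lemma wbisim_interp_state:
  assumes handlers: "\<And>e s. e \<in> ev \<Longrightarrow>
      wbisim dans (\<lambda>p q. p = q \<and> fst p \<in> ans e) (h1 e s) (h2 e s)"
    and typed: "itree_typed (ev <+> D) (case_sum ans dans) R t"
  shows "wbisim dans (\<lambda>p q. p = q \<and> fst p \<in> R) (interp_state h1 t s) (interp_state h2 t s)"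
proof -
  let ?T = "itree_typed (ev <+> D) (case_sum ans dans) R"
  \<comment> \<open>The first disjunct is the phase between handler calls; the second is a pending
    call to a handler of \<open>e\<close>, where only the handler trees may differ.\<close>
  define S where "S x y \<longleftrightarrow>
      (\<exists>t s. ?T t \<and> x = interp_config h1 (Main t s) \<and> y = interp_config h2 (Main t s)) \<or>
      (\<exists>e u1 u2 k. wbisim dans (\<lambda>p q. p = q \<and> fst p \<in> ans e) u1 u2 \<and> (\<forall>a\<in>ans e. ?T (k a)) \<and>
         x = interp_config h1 (Call u1 k) \<and> y = interp_config h2 (Call u2 k))" for x y
  have S_Main: "S (interp_config h1 (Main t s)) (interp_config h2 (Main t s))" if "?T t" for t s
    unfolding S_def using that by blast
  have S_Call: "S (interp_config h1 (Call u1 k)) (interp_config h2 (Call u2 k))"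
    if "wbisim dans (\<lambda>p q. p = q \<and> fst p \<in> ans e) u1 u2" "\<forall>a\<in>ans e. ?T (k a)" for e u1 u2 k
    unfolding S_def using that by blast
  show ?thesis
    unfolding interp_state_def
  proof (rule wbisim_coinduct_step[where S = S])
    fix x y
    assume "S x y"
    then consider
        (Main) t s where "?T t" "x = interp_config h1 (Main t s)" "y = interp_config h2 (Main t s)"
      | (Call) e u1 u2 k where "wbisim dans (\<lambda>p q. p = q \<and> fst p \<in> ans e) u1 u2"
          "\<forall>a\<in>ans e. ?T (k a)"
          "x = interp_config h1 (Call u1 k)" "y = interp_config h2 (Call u2 k)"
      unfolding S_def by blast
    then show "wbisim_step dans (\<lambda>p q. p = q \<and> fst p \<in> R) S x y"
    proof cases
      case Main
      from Main(1) show ?thesis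
      proof cases
        case (3 e k)
        then show ?thesis
          using Main(2,3)
          by (cases e)
            (auto simp: interp_config_simps intro!: wbisim_step.Tau wbisim_step.Vis S_Main
              intro: S_Call handlers)
      qed (use Main(2,3) in
          \<open>auto simp: interp_config_simps intro!: wbisim_step.Ret wbisim_step.Tau S_Main\<close>)
    next
      case Call
      \<comment> \<open>One-sided \<open>Tau\<close> steps of the handlers become one-sided steps of
        the configurations. Two returning handlers give a \<open>Tau\<close> on each side, leading
        back to \<open>Main\<close>.\<close>
      from Call(1)[THEN wbisim_unfold] show ?thesis
        unfolding Call(3,4)
        by induction
          (use Call(2) in \<open>auto simp: interp_config_simps
            intro: wbisim_step.TauL wbisim_step.TauR
            intro!: wbisim_step.Tau wbisim_step.Vis S_Main S_Call\<close>)
    qed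
  qed (rule S_Main[OF typed])
qed

lemma wbisim_interp:
  assumes "\<And>e. e \<in> ev \<Longrightarrow> wbisim dans (\<lambda>a b. a = b \<and> a \<in> ans e) (h1 e) (h2 e)"
    and "itree_typed (ev <+> D) (case_sum ans dans) R t"
  shows "wbisim dans (\<lambda>r s. r = s \<and> r \<in> R) (interp h1 t) (interp h2 t)"
  unfolding interp_def
proof (rule wbisim_map_itree)
  show "wbisim dans (\<lambda>p q. p = q \<and> fst p \<in> R)
      (interp_state (\<lambda>e _. map_itree (\<lambda>a. (a, ())) (h1 e)) t ())
      (interp_state (\<lambda>e _. map_itree (\<lambda>a. (a, ())) (h2 e)) t ())"
  proof (rule wbisim_interp_state[OF _ assms(2)])
    show "wbisim dans (\<lambda>p q. p = q \<and> fst p \<in> ans e)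
        (map_itree (\<lambda>a. (a, ())) (h1 e)) (map_itree (\<lambda>a. (a, ())) (h2 e))" if "e \<in> ev" for e
      by (rule wbisim_map_itree[OF assms(1)[OF that]]) simp
  qed
qed simp

section \<open>Runs of a program and of its compilation\<close>

lemma drop_err_simps:
  "drop_err (Ret r) = Ret r"
  "drop_err (Tau t) = Tau (drop_err t)"
  "drop_err (Vis (Inr d) k) = Vis d (\<lambda>a. drop_err (k a))"
  by (subst drop_err.code; simp)+

text \<open>Matching \<open>Vis\<close> nodes carry the same event, so excluding \<open>Err\<close>
  events from \<open>t1\<close> covers all nodes that the bisimulation visits. Results are compared
  only where reachable in \<open>t1\<close>, since safety speaks only of those.\<close>

lemma wbisim_drop_err_map:
  assumes "wbisim (case_sum err_ans dans) \<phi> t1 t2"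
    and "\<And>e k. \<not> subtree (case_sum err_ans dans) t1 (Vis (Inl e) k)"
    and "\<And>r s. \<phi> r s \<Longrightarrow> subtree (case_sum err_ans dans) t1 (Ret r) \<Longrightarrow> \<psi> (f r) (g s)"
  shows "wbisim dans \<psi> (drop_err (map_itree f t1)) (drop_err (map_itree g t2))"
proof -
  let ?ans = "case_sum err_ans dans"
  \<comment> \<open>The inclusion of subtrees transports both side conditions from \<open>t1\<close>
    to the residual tree \<open>u1\<close>.\<close>
  define S where "S x y \<longleftrightarrow>
      (\<exists>u1 u2. x = drop_err (map_itree f u1) \<and> y = drop_err (map_itree g u2) \<and>
         wbisim ?ans \<phi> u1 u2 \<and> subtree ?ans u1 \<le> subtree ?ans t1)" for x y
  have S_intro: "S (drop_err (map_itree f u1)) (drop_err (map_itree g u2))"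
    if "wbisim ?ans \<phi> u1 u2" "\<And>v. subtree ?ans u1 v \<Longrightarrow> subtree ?ans t1 v" for u1 u2
    unfolding S_def using that by blast
  show ?thesis
  proof (rule wbisim_coinduct_step[where S = S])
    show "S (drop_err (map_itree f t1)) (drop_err (map_itree g t2))"
      using assms(1) by (rule S_intro)
    fix x y
    assume "S x y"
    then obtain u1 u2 where xy: "x = drop_err (map_itree f u1)" "y = drop_err (map_itree g u2)"
      and bisim: "wbisim ?ans \<phi> u1 u2"
      and sub: "\<And>v. subtree ?ans u1 v \<Longrightarrow> subtree ?ans t1 v"
      unfolding S_def by blast
    \<comment> \<open>\<open>sub\<close> is fed to the induction because \<open>u1\<close> shrinks
      at each left \<open>Tau\<close>.\<close>
    from bisim[THEN wbisim_unfold] sub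
    show "wbisim_step dans \<psi> S x y"
      unfolding xy
    proof induction
      case (Vis e k1 k2)
      from Vis.prems[OF subtree.intros(1)] assms(2) obtain d where "e = Inr d"
        by (cases e) auto
      have "S (drop_err (map_itree f (k1 a))) (drop_err (map_itree g (k2 a)))"
        if "a \<in> dans d" for a
      proof (rule S_intro)
        have a: "a \<in> ?ans e"
          using that \<open>e = Inr d\<close> by simp
        then show "wbisim ?ans \<phi> (k1 a) (k2 a)"
          using Vis.hyps by blast
        show "subtree ?ans t1 v" if "subtree ?ans (k1 a) v" for v
          using a that by (intro Vis.prems) (rule subtree.intros(3))
      qed
      then show ?case
        by (simp add: \<open>e = Inr d\<close> drop_err_simps o_def wbisim_step.Vis)
    next
      case (Ret r1 r2)
      then show ?case
        by (simp add: drop_err_simps wbisim_step.Ret assms(3) subtree.intros(1))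
    next
      case (Tau t1 t2)
      then show ?case
        by (simp add: drop_err_simps wbisim_step.Tau S_intro subtree.intros(2))
    next
      case (TauL t1 t2)
      then show ?case
        by (simp add: drop_err_simps wbisim_step.TauL subtree.intros(2))
    next
      case (TauR t1 t2)
      then show ?case
        by (simp add: drop_err_simps wbisim_step.TauR)
    qed
  qed
qed

text \<open>Safety supplies both side conditions of \<open>wbisim_drop_err_map\<close>: absence of
  \<open>Err\<close> events and initialized results.\<close>

lemma wbisim_Run:
  assumes "wbisim (case_sum err_ans support) R (P f (in_P f x)) (Q f (in_Q f x))"
    and "safe err_ans initialized P f (in_P f x)"
    and "\<And>\<sigma> \<tau>. R \<sigma> \<tau> \<Longrightarrow> initialized f \<sigma> \<Longrightarrow> \<psi> (out_P f \<sigma>) (out_Q f \<tau>)"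
  shows "wbisim support \<psi> (Run P in_P out_P f x) (Run Q in_Q out_Q f x)"
  unfolding Run_def
proof (rule wbisim_drop_err_map[OF assms(1)])
  show "\<not> subtree (case_sum err_ans support) (P f (in_P f x)) (Vis (Inl e) k)" for e k
    using assms(2) unfolding safe_def by blast
  show "\<psi> (out_P f \<sigma>) (out_Q f \<tau>)"
    if "R \<sigma> \<tau>" "subtree (case_sum err_ans support) (P f (in_P f x)) (Ret \<sigma>)" for \<sigma> \<tau>
    using assms(2) that(2) unfolding safe_def by (blast intro: assms(3)[OF that(1)])
qed

section \<open>Probabilistic semantics\<close>

lemma support_rnd: "finite (support X)" "support X \<noteq> {}"
  using support[of X] by auto

lemma average_mono:
  assumes "\<And>x. x \<in> support X \<Longrightarrow> p x \<le> (q x :: real)"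
  shows "(1 / real (card (support X))) * (\<Sum>x\<in>support X. p x)
       \<le> (1 / real (card (support X))) * (\<Sum>x\<in>support X. q x)"
  by (intro mult_left_mono sum_mono assms) auto

lemma sem_upto_mono_Suc: "sem_upto n t r \<le> sem_upto (Suc n) t r"
proof (induction n arbitrary: t)
  case 0
  show ?case
    by (cases t) auto
next
  case (Suc n)
  show ?case
  proof (cases t)
    case (Tau t')
    then show ?thesis
      using Suc[of t'] by simp
  next
    case (Vis e k)
    then show ?thesis
      using average_mono[OF Suc, of e k] by simp
  qed simp
qed

lemma sem_upto_le_1: "sem_upto n t r \<le> 1"
proof (induction n arbitrary: t)
  case (Suc n)
  show ?case
  proof (cases t)
    case (Vis e k)
    \<comment> \<open>The comparison is with the constant 1, whose average is 1 because the support
      is finite and nonempty.\<close>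
    then show ?thesis
      using average_mono[of e "\<lambda>x. sem_upto n (k x) r" "\<lambda>_. 1"] Suc support_rnd[of e] by simp
  qed (use Suc in auto)
qed simp

text \<open>The approximations increase and are bounded by 1, so the \<open>lim\<close> in
  \<open>sem\<close> is a genuine limit and an upper bound.\<close>

lemma sem_upto_LIMSEQ: "(\<lambda>n. sem_upto n t r) \<longlonglongrightarrow> sem t r"
  and sem_upto_le_sem: "sem_upto n t r \<le> sem t r"
proof -
  have inc: "incseq (\<lambda>n. sem_upto n t r)"
    by (intro incseq_SucI sem_upto_mono_Suc)
  obtain l where "(\<lambda>n. sem_upto n t r) \<longlonglongrightarrow> l"
    by (rule incseq_convergent[OF inc, of 1]) (simp add: sem_upto_le_1)
  then show lim: "(\<lambda>n. sem_upto n t r) \<longlonglongrightarrow> sem t r"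
    by (simp add: sem_def limI)
  show "sem_upto n t r \<le> sem t r"
    by (rule incseq_le[OF inc lim])
qed

lemma sem_simps:
  "sem (Ret r') r = of_bool (r = r')"
  "sem (Tau t) r = sem t r"
  "sem (Vis e k) r = (1 / real (card (support e))) * (\<Sum>x\<in>support e. sem (k x) r)"
proof -
  \<comment> \<open>Shifting the index keeps the limit and exposes the recursive equation of
    \<open>sem_upto\<close>.\<close>
  have eqI: "sem t r = l" if "(\<lambda>n. sem_upto (Suc n) t r) \<longlonglongrightarrow> l" for t and l
    using LIMSEQ_unique[OF LIMSEQ_Suc[OF sem_upto_LIMSEQ] that] .
  show "sem (Ret r') r = of_bool (r = r')"
    by (rule eqI) simp
  show "sem (Tau t) r = sem t r"
    by (rule eqI) (simp add: sem_upto_LIMSEQ)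
  show "sem (Vis e k) r = (1 / real (card (support e))) * (\<Sum>x\<in>support e. sem (k x) r)"
    by (rule eqI) (simp only: sem_upto.simps itree.case, intro tendsto_mult_left tendsto_sum sem_upto_LIMSEQ)
qed

text \<open>The right side is the limit, since \<open>t2\<close> may take any finite number of extra
  \<open>Tau\<close> steps. The outer induction on \<open>n\<close> pays for steps taken on both
  sides; the inner one, on \<open>wbisim_step\<close>, handles one-sided steps.\<close>

lemma sem_upto_le_sem_wbisim:
  assumes "wbisim support (=) t1 t2"
  shows "sem_upto n t1 r \<le> sem t2 r"
  using assms
proof (induction n arbitrary: t1 t2)
  case 0
  show ?case
    using sem_upto_le_sem[of 0] by simp
next
  case (Suc n)
  from Suc.prems[THEN wbisim_unfold] show ?case
  proof induction
    case (Ret r1 r2)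
    then show ?case
      by (simp add: sem_simps)
  next
    case (Tau t1 t2)
    then show ?case
      by (simp add: sem_simps Suc.IH)
  next
    case (Vis e k1 k2)
    then show ?case
      using average_mono[of e "\<lambda>x. sem_upto n (k1 x) r" "\<lambda>x. sem (k2 x) r"]
      by (simp add: sem_simps Suc.IH)
  next
    \<comment> \<open>The \<open>Tau\<close> uses up one unit of depth, and monotonicity in the
      depth restores it for the inner hypothesis.\<close>
    case (TauL t1 t2)
    then show ?case
      using sem_upto_mono_Suc[of n t1 r] by simp
  next
    case (TauR t1 t2)
    then show ?case
      by (simp add: sem_simps)
  qed
qed

lemma sem_le_wbisim:
  assumes "wbisim support (=) t1 t2"
  shows "sem t1 r \<le> sem t2 r"
  by (rule LIMSEQ_le_const2[OF sem_upto_LIMSEQ]) (simp add: sem_upto_le_sem_wbisim[OF assms])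

lemma sem_eq_wbisim:
  assumes "wbisim support (=) t1 t2"
  shows "sem t1 r = sem t2 r"
proof (rule antisym)
  have "wbisim support (=) t2 t1"
    using wbisim_sym[OF assms] by (simp add: eq_commute)
  then show "sem t2 r \<le> sem t1 r"
    by (rule sem_le_wbisim)
qed (rule sem_le_wbisim[OF assms])

section \<open>Games\<close>

lemma wbisim_induced:
  assumes "oracle_impl_typed X Y I Out orc"
    and "\<And>f x. x \<in> X f \<Longrightarrow> wbisim support (\<lambda>a b. a = b \<and> a \<in> Y f) (run1 f x) (run2 f x)"
    and "i \<in> I n"
  shows "wbisim support (\<lambda>p q. p = q \<and> fst p \<in> Out n)
           (induced orc run1 n (i, \<mu>)) (induced orc run2 n (i, \<mu>))"
proof -
  have "wbisim support (\<lambda>p q. p = q \<and> p \<in> Out n \<times> UNIV)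
          (induced orc run1 n (i, \<mu>)) (induced orc run2 n (i, \<mu>))"
    unfolding induced_def
  proof (rule wbisim_interp)
    show "itree_typed (calls X <+> UNIV) (case_sum (call_ans Y) support) (Out n \<times> UNIV)
            (orc n (i, \<mu>))"
      using assms(1,3) by (simp add: oracle_impl_typed_def)
  qed (auto simp: calls_def assms(2))
  then show ?thesis
    by (simp add: mem_Times_iff)
qed

text \<open>The interpreter state is the memory paired with the trace. Equal answers and memories
  extend equal traces equally.\<close>

lemma wbisim_game:
  assumes "adversary_typed I Out A"
    and "\<And>n i \<mu>. i \<in> I n \<Longrightarrow>
      wbisim support (\<lambda>p q. p = q \<and> fst p \<in> Out n) (C1 n (i, \<mu>)) (C2 n (i, \<mu>))"
  shows "wbisim support (=) (game \<mu>0 A C1) (game \<mu>0 A C2)"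
  unfolding game_def
proof (rule wbisim_map_itree[OF wbisim_interp_state])
  show "itree_typed (queries I <+> UNIV) (case_sum (query_ans Out) support) UNIV A"
    using assms(1) by (simp add: adversary_typed_def)
  fix e s
  assume "e \<in> queries I"
  then obtain n i where "e = Que n i" "i \<in> I n"
    by (auto simp: queries_def)
  then show "wbisim support (\<lambda>p q. p = q \<and> fst p \<in> query_ans Out e)
      (answer_query C1 e s) (answer_query C2 e s)"
    by (auto intro!: wbisim_map_itree[OF assms(2)])
qed auto

theorem theorem4p5:
  fixes P :: "('f, 'src, 'err, 'v) program"
    and Q :: "('f, 'tgt, 'err, 'v) program"
    and err_ans :: "'err \<Rightarrow> 'v set"
    and initialized :: "'f \<Rightarrow> 'src \<Rightarrow> bool"
    and L :: "('f, 'tgt) target_layout"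
    and R :: "'src \<Rightarrow> 'tgt \<Rightarrow> bool"
    and X Y :: "'f \<Rightarrow> 'v set"
    and in_P :: "'f \<Rightarrow> 'v \<Rightarrow> 'src" and out_P :: "'f \<Rightarrow> 'src \<Rightarrow> 'v"
    and in_Q :: "'f \<Rightarrow> 'v \<Rightarrow> 'tgt" and out_Q :: "'f \<Rightarrow> 'tgt \<Rightarrow> 'v"
    and I Out :: "nat \<Rightarrow> 'v set"
    and \<mu>0 :: 'm
    and orc :: "('f, 'v, 'm) oracle_impl"
    and A :: "'v adversary"
    and win :: "'v trace \<Rightarrow> bool"
  assumes compilation: "compiler_correct err_ans initialized L R P Q"
    and safety: "\<And>f x. x \<in> X f \<Longrightarrow> safe err_ans initialized P f (in_P f x)"
    and stack: "\<And>f x. x \<in> X f \<Longrightarrow> enough_stack L f (in_Q f x)"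
    and pointers: "\<And>f x. x \<in> X f \<Longrightarrow> ptrs_disjoint L f (in_Q f x)"
    and inputs_related: "\<And>f x. x \<in> X f \<Longrightarrow> R (in_P f x) (in_Q f x)"
    and outputs_equal:
      "\<And>f \<sigma>' \<tau>'. R \<sigma>' \<tau>' \<Longrightarrow> initialized f \<sigma>' \<Longrightarrow> out_P f \<sigma>' = out_Q f \<tau>'"
    and out_P_typed: "\<And>f \<sigma>'. out_P f \<sigma>' \<in> Y f"
    and out_Q_typed: "\<And>f \<tau>'. out_Q f \<tau>' \<in> Y f"
    and oracles: "oracle_impl_typed X Y I Out orc"
    and adversary: "adversary_typed I Out A"
  shows "win_prob I Out \<mu>0 win A (induced orc (Run P in_P out_P)) =
         win_prob I Out \<mu>0 win A (induced orc (Run Q in_Q out_Q))"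
proof -
  have run: "wbisim support (\<lambda>a b. a = b \<and> a \<in> Y f) (Run P in_P out_P f x) (Run Q in_Q out_Q f x)"
    if "x \<in> X f" for f x
  proof (rule wbisim_Run)
    show "wbisim (case_sum err_ans support) R (P f (in_P f x)) (Q f (in_Q f x))"
      using compilation safety[OF that] stack[OF that] pointers[OF that] inputs_related[OF that]
      by (simp add: compiler_correct_def)
    show "safe err_ans initialized P f (in_P f x)"
      by (rule safety[OF that])
    \<comment> \<open>Membership in \<open>Y f\<close> keeps the answers where the oracle
      continuations are typed.\<close>
    show "out_P f \<sigma> = out_Q f \<tau> \<and> out_P f \<sigma> \<in> Y f" if "R \<sigma> \<tau>" "initialized f \<sigma>" for \<sigma> \<tau>
      using outputs_equal[OF that] out_P_typed[of f \<sigma>] by simp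
  qed
  have "wbisim support (=) (game \<mu>0 A (induced orc (Run P in_P out_P)))
          (game \<mu>0 A (induced orc (Run Q in_Q out_Q)))"
    by (rule wbisim_game[OF adversary]) (rule wbisim_induced[OF oracles run])
  \<comment> \<open>Both sums range over the same winning traces and agree term by term.\<close>
  then show ?thesis
    by (simp add: win_prob_def sem_eq_wbisim)
qed

end
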